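(* Let $M\ge1$, $B_c>0$, $P>0$, and $\Gamma_{1,m}\ge\Gamma_{2,m}>0$ for $m=1,\dots,M$. Consider the maximin fairness power allocation problem over $\boldsymbol p_1=(p_{1,m})_{m=1}^M$, $\boldsymbol p_2=(p_{2,m})_{m=1}^M$: $$\max\ \min_{m=1,\dots,M}\{R_{1,m},R_{2,m}\}\quad\text{s.t.}\quad 0\le p_{1,m}\le p_{2,m}\ \forall m,\ \ \sum_{m=1}^M(p_{1,m}+p_{2,m})\le P,$$ where $R_{1,m}=B_c\log(1+p_{1,m}\Gamma_{1,m})$ and $R_{2,m}=B_c\log\left(1+\frac{p_{2,m}\Gamma_{2,m}}{p_{1,m}\Gamma_{2,m}+1}\right)$. Then the NOMA system is SIC-stable for this problem, i.e. the optimal power allocation satisfies $p_{1,m}<p_{2,m}$ for every $m=1,\dots,M$.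
   Context: Setting: downlink NOMA with $M$ channels, each shared by two users; $\Gamma_{l,m}>0$ is the channel-to-noise ratio of user $l$ on channel $m$, $p_{l,m}$ its power, $R_{l,m}$ its rate, $P$ the total power budget, $B_c$ the bandwidth of each channel. $\log$ is the base-2 logarithm. Definition: a NOMA system is called SIC-stable (for a given power allocation problem) if the optimal power allocation satisfies $p_{1,m}<p_{2,m}$ on each channel $m$. *)

theory Defs
  imports Complex_Main
begin

text \<open>
  A family such as $p_{l,m}$ or $\Gamma_{l,m}$ is a function \<open>nat \<Rightarrow> nat \<Rightarrow> real\<close>, applied first to the
  user \<open>l \<in> {1, 2}\<close> and then to the channel \<open>m \<in> {1..M}\<close>; values at other indices are irrelevant.
\<close>
type_synonym allocation = "nat \<Rightarrow> nat \<Rightarrow> real"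

text \<open>
  User 1 is free of intra-channel interference after successive interference cancellation (SIC);
  user 2 is decoded while treating the signal of user 1 as noise.
\<close>
definition rate1 :: "real \<Rightarrow> (nat \<Rightarrow> nat \<Rightarrow> real) \<Rightarrow> allocation \<Rightarrow> nat \<Rightarrow> real" where
  "rate1 Bc \<Gamma> p m = Bc * log 2 (1 + p 1 m * \<Gamma> 1 m)"

definition rate2 :: "real \<Rightarrow> (nat \<Rightarrow> nat \<Rightarrow> real) \<Rightarrow> allocation \<Rightarrow> nat \<Rightarrow> real" where
  "rate2 Bc \<Gamma> p m = Bc * log 2 (1 + p 2 m * \<Gamma> 2 m / (p 1 m * \<Gamma> 2 m + 1))"

definition feasible :: "nat \<Rightarrow> real \<Rightarrow> allocation \<Rightarrow> bool" where
  "feasible M P p \<longleftrightarrow>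
     (\<forall>m\<in>{1..M}. 0 \<le> p 1 m \<and> p 1 m \<le> p 2 m) \<and> (\<Sum>m=1..M. p 1 m + p 2 m) \<le> P"

definition min_rate :: "nat \<Rightarrow> real \<Rightarrow> (nat \<Rightarrow> nat \<Rightarrow> real) \<Rightarrow> allocation \<Rightarrow> real" where
  "min_rate M Bc \<Gamma> p = Min (rate1 Bc \<Gamma> p ` {1..M} \<union> rate2 Bc \<Gamma> p ` {1..M})"

text \<open>
  SIC-stability for the problem of maximizing \<open>U p\<close> over all \<open>p\<close> with \<open>F p\<close>. Speaking of ``the optimal
  power allocation'' presupposes that one exists, so existence of a maximizer is part of the notion,
  and the strict inequality is required of every maximizer.
\<close>
definition SIC_stable :: "nat \<Rightarrow> (allocation \<Rightarrow> bool) \<Rightarrow> (allocation \<Rightarrow> real) \<Rightarrow> bool" where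
  "SIC_stable M F U \<longleftrightarrow>
     (\<exists>p. is_arg_max U F p) \<and> (\<forall>p. is_arg_max U F p \<longrightarrow> (\<forall>m\<in>{1..M}. p 1 m < p 2 m))"

end

theory Submission imports Defs begin

text \<open>
  A common rate \<open>Bc * log 2 (1 + t)\<close> requires \<open>p 1 m \<ge> t / \<Gamma> 1 m\<close> and
  \<open>p 2 m \<ge> t * (p 1 m + 1 / \<Gamma> 2 m)\<close>, so the allocation that satisfies both with equality is the
  pointwise least one achieving this rate. Its total power is continuous in \<open>t\<close>, vanishes at
  \<open>t = 0\<close> and is unbounded, hence some \<open>t > 0\<close> uses exactly the budget \<open>P\<close>. Any feasible allocation
  that does at least as well dominates this one pointwise without exceeding its total power, hence
  coincides with it; and \<open>t * (t / \<Gamma> 1 m + 1 / \<Gamma> 2 m) > t / \<Gamma> 1 m\<close> because \<open>\<Gamma> 2 m \<le> \<Gamma> 1 m\<close>.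
\<close>

text \<open>The parameter \<open>t\<close> is the signal-to-interference-plus-noise ratio common to
  all users; used in place of the rate, it makes the powers polynomial. Every \<open>l\<close> other
  than 1 counts as user 2, so nonnegativity can be shown for all \<open>l\<close> at once.\<close>

definition balanced :: "(nat \<Rightarrow> nat \<Rightarrow> real) \<Rightarrow> real \<Rightarrow> allocation" where
  "balanced \<Gamma> t l m = (if l = 1 then t / \<Gamma> 1 m else t * (t / \<Gamma> 1 m + 1 / \<Gamma> 2 m))"

lemma le_rate1_iff:
  assumes "Bc > 0" "t \<ge> 0" "\<Gamma> 1 m > 0" "p 1 m \<ge> 0"
  shows "Bc * log 2 (1 + t) \<le> rate1 Bc \<Gamma> p m \<longleftrightarrow> t / \<Gamma> 1 m \<le> p 1 m"
  using assms by (simp add: rate1_def pos_divide_le_eq add_pos_nonneg)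

text \<open>Clearing the positive interference-plus-noise denominator leaves a lower bound on
  \<open>p 2 m\<close> that grows with \<open>p 1 m\<close>.\<close>

lemma le_rate2_iff:
  assumes "Bc > 0" "t \<ge> 0" "\<Gamma> 2 m > 0" "p 1 m \<ge> 0" "p 2 m \<ge> 0"
  shows "Bc * log 2 (1 + t) \<le> rate2 Bc \<Gamma> p m \<longleftrightarrow> t * (p 1 m + 1 / \<Gamma> 2 m) \<le> p 2 m"
proof -
  have noise: "p 1 m * \<Gamma> 2 m + 1 > 0"
    using assms by (simp add: add_nonneg_pos)
  have "Bc * log 2 (1 + t) \<le> rate2 Bc \<Gamma> p m
      \<longleftrightarrow> t \<le> p 2 m * \<Gamma> 2 m / (p 1 m * \<Gamma> 2 m + 1)"
    using assms by (simp add: rate2_def add_pos_nonneg)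
  also have "\<dots> \<longleftrightarrow> t * (p 1 m * \<Gamma> 2 m + 1) \<le> p 2 m * \<Gamma> 2 m"
    using noise by (simp add: pos_le_divide_eq)
  also have "t * (p 1 m * \<Gamma> 2 m + 1) = t * (p 1 m + 1 / \<Gamma> 2 m) * \<Gamma> 2 m"
    using assms by (simp add: field_simps)
  also have "\<dots> \<le> p 2 m * \<Gamma> 2 m \<longleftrightarrow> t * (p 1 m + 1 / \<Gamma> 2 m) \<le> p 2 m"
    using assms by simp
  finally show ?thesis .
qed

lemma le_min_rate_iff:
  assumes "M \<ge> 1"
  shows "r \<le> min_rate M Bc \<Gamma> p \<longleftrightarrow> (\<forall>m\<in>{1..M}. r \<le> rate1 Bc \<Gamma> p m \<and> r \<le> rate2 Bc \<Gamma> p m)"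
  unfolding min_rate_def using assms by (subst Min_ge_iff) auto

text \<open>Allocations are total functions, so an optimum is determined only on the indices in use;
  this replaces equality of allocations.\<close>

lemma min_rate_cong:
  assumes "\<And>m. m \<in> {1..M} \<Longrightarrow> p 1 m = q 1 m" "\<And>m. m \<in> {1..M} \<Longrightarrow> p 2 m = q 2 m"
  shows "min_rate M Bc \<Gamma> p = min_rate M Bc \<Gamma> q"
proof -
  have "rate1 Bc \<Gamma> p ` {1..M} = rate1 Bc \<Gamma> q ` {1..M}"
    using assms by (intro image_cong) (auto simp: rate1_def)
  moreover have "rate2 Bc \<Gamma> p ` {1..M} = rate2 Bc \<Gamma> q ` {1..M}"
    using assms by (intro image_cong) (auto simp: rate2_def)
  ultimately show ?thesis
    by (simp add: min_rate_def)
qed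

lemma balanced_less:
  assumes "t > 0" "\<Gamma> 2 m > 0" "\<Gamma> 2 m \<le> \<Gamma> 1 m"
  shows "balanced \<Gamma> t 1 m < balanced \<Gamma> t 2 m"
proof -
  have "t / \<Gamma> 1 m \<le> t / \<Gamma> 2 m"
    using assms by (intro divide_left_mono) auto
  \<comment> \<open>Strictness comes from the quadratic term, the power that offsets the
    interference from user 1.\<close>
  also have "\<dots> < t * (t / \<Gamma> 1 m) + t / \<Gamma> 2 m"
    using assms by simp
  finally show ?thesis
    by (simp add: balanced_def distrib_left)
qed

lemma ex_balanced_budget:
  assumes "M \<ge> 1" "P > 0" and pos: "\<And>m. m \<in> {1..M} \<Longrightarrow> \<Gamma> 1 m > 0 \<and> \<Gamma> 2 m > 0"
  shows "\<exists>t>0. (\<Sum>m=1..M. balanced \<Gamma> t 1 m + balanced \<Gamma> t 2 m) = P"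
proof -
  define C where "C t = (\<Sum>m=1..M. balanced \<Gamma> t 1 m + balanced \<Gamma> t 2 m)" for t
  \<comment> \<open>At this value user 1 on channel 1 alone consumes the whole budget, so the total
    is at least \<open>P\<close>.\<close>
  define T where "T = P * \<Gamma> 1 1"
  have pos1: "\<Gamma> 1 1 > 0"
    using pos[of 1] assms by simp
  then have T: "T > 0"
    using assms by (simp add: T_def)
  have nonneg: "0 \<le> balanced \<Gamma> T l m" if "m \<in> {1..M}" for l m
    using pos[OF that] T by (simp add: balanced_def)
  have "P = balanced \<Gamma> T 1 1"
    using pos1 by (simp add: balanced_def T_def)
  also have "\<dots> \<le> balanced \<Gamma> T 1 1 + balanced \<Gamma> T 2 1"
    using nonneg[of 1 2] assms by simp
  also have "\<dots> \<le> C T"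
    unfolding C_def using assms nonneg by (intro member_le_sum) (auto intro: add_nonneg_nonneg)
  finally have "P \<le> C T" .
  moreover have C0: "C 0 = 0"
    by (simp add: C_def balanced_def)
  moreover have "continuous_on {0..T} C"
    using pos by (auto simp: C_def balanced_def less_imp_neq[symmetric] intro!: continuous_intros)
  ultimately obtain t where "0 \<le> t" "C t = P"
    using IVT'[of C 0 P T] assms T by auto
  moreover from this have "t \<noteq> 0"
    using C0 assms by auto
  ultimately show ?thesis
    by (auto simp: C_def intro!: exI[of _ t])
qed

text \<open>Assuming a rate threshold instead of optimality lets this serve both for the existence
  of a maximizer and for its uniqueness on the channels.\<close>

lemma eq_balanced:
  assumes "M \<ge> 1" "Bc > 0" "t \<ge> 0" and pos: "\<And>m. m \<in> {1..M} \<Longrightarrow> \<Gamma> 1 m > 0 \<and> \<Gamma> 2 m > 0"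
    and budget: "(\<Sum>m=1..M. balanced \<Gamma> t 1 m + balanced \<Gamma> t 2 m) = P"
    and feas: "feasible M P q" and rate: "Bc * log 2 (1 + t) \<le> min_rate M Bc \<Gamma> q"
    and m: "m \<in> {1..M}"
  shows "q 1 m = balanced \<Gamma> t 1 m \<and> q 2 m = balanced \<Gamma> t 2 m"
proof -
  have dom: "balanced \<Gamma> t 1 k \<le> q 1 k \<and> balanced \<Gamma> t 2 k \<le> q 2 k" if k: "k \<in> {1..M}" for k
  proof -
    have q: "0 \<le> q 1 k" "0 \<le> q 2 k"
      using feas k unfolding feasible_def by force+
    have 1: "t / \<Gamma> 1 k \<le> q 1 k"
      using rate le_rate1_iff[of Bc t \<Gamma> k q] pos[OF k] q k assms(1-3) by (simp add: le_min_rate_iff)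
    have "t * (t / \<Gamma> 1 k + 1 / \<Gamma> 2 k) \<le> t * (q 1 k + 1 / \<Gamma> 2 k)"
      using 1 assms(3) by (intro mult_left_mono) auto
    also have "\<dots> \<le> q 2 k"
      using rate le_rate2_iff[of Bc t \<Gamma> k q] pos[OF k] q k assms(1-3) by (simp add: le_min_rate_iff)
    finally show ?thesis
      using 1 by (simp add: balanced_def)
  qed
  have "(\<Sum>k=1..M. balanced \<Gamma> t 1 k + balanced \<Gamma> t 2 k) = (\<Sum>k=1..M. q 1 k + q 2 k)"
  proof (rule antisym)
    show "(\<Sum>k=1..M. balanced \<Gamma> t 1 k + balanced \<Gamma> t 2 k) \<le> (\<Sum>k=1..M. q 1 k + q 2 k)"
      using dom by (intro sum_mono add_mono) auto
    show "(\<Sum>k=1..M. q 1 k + q 2 k) \<le> (\<Sum>k=1..M. balanced \<Gamma> t 1 k + balanced \<Gamma> t 2 k)"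
      using feas budget by (simp add: feasible_def)
  qed
  \<comment> \<open>Termwise inequalities whose sums agree are equalities.\<close>
  then have "balanced \<Gamma> t 1 m + balanced \<Gamma> t 2 m = q 1 m + q 2 m"
    by (rule sum_mono_inv) (use dom m in \<open>auto intro: add_mono\<close>)
  then show ?thesis
    using dom[OF m] by linarith
qed

theorem lemma1:
  fixes M :: nat and Bc P :: real and \<Gamma> :: "nat \<Rightarrow> nat \<Rightarrow> real"
  assumes "M \<ge> 1" and "Bc > 0" and "P > 0"
    and "\<And>m. m \<in> {1..M} \<Longrightarrow> \<Gamma> 1 m \<ge> \<Gamma> 2 m"
    and "\<And>m. m \<in> {1..M} \<Longrightarrow> \<Gamma> 2 m > 0"
  shows "SIC_stable M (feasible M P) (min_rate M Bc \<Gamma>)"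
proof -
  have pos: "\<Gamma> 1 m > 0 \<and> \<Gamma> 2 m > 0" if "m \<in> {1..M}" for m
    using assms(4,5)[OF that] by linarith
  obtain t where t: "t > 0"
    and budget: "(\<Sum>m=1..M. balanced \<Gamma> t 1 m + balanced \<Gamma> t 2 m) = P"
    using ex_balanced_budget[of M P \<Gamma>] assms(1,3) pos by blast
  have less: "balanced \<Gamma> t 1 m < balanced \<Gamma> t 2 m" if "m \<in> {1..M}" for m
    using balanced_less t assms(4,5) that by blast
  have nonneg: "0 \<le> balanced \<Gamma> t l m" if "m \<in> {1..M}" for l m
    using pos[OF that] t by (simp add: balanced_def)
  have feas: "feasible M P (balanced \<Gamma> t)"
    using less nonneg budget by (auto simp: feasible_def intro: less_imp_le)
  have rate: "Bc * log 2 (1 + t) \<le> min_rate M Bc \<Gamma> (balanced \<Gamma> t)"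
    unfolding le_min_rate_iff[OF assms(1)]
  proof (intro ballI conjI)
    fix m assume m: "m \<in> {1..M}"
    show "Bc * log 2 (1 + t) \<le> rate1 Bc \<Gamma> (balanced \<Gamma> t) m"
      using le_rate1_iff[of Bc t \<Gamma> m "balanced \<Gamma> t"] assms(2) t pos[OF m] nonneg[OF m]
      by (simp add: balanced_def)
    show "Bc * log 2 (1 + t) \<le> rate2 Bc \<Gamma> (balanced \<Gamma> t) m"
      using le_rate2_iff[of Bc t \<Gamma> m "balanced \<Gamma> t"] assms(2) t pos[OF m] nonneg[OF m]
      by (simp add: balanced_def)
  qed
  have unique: "q 1 m = balanced \<Gamma> t 1 m \<and> q 2 m = balanced \<Gamma> t 2 m"
    if "feasible M P q" "min_rate M Bc \<Gamma> (balanced \<Gamma> t) \<le> min_rate M Bc \<Gamma> q" "m \<in> {1..M}" for q m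
    using eq_balanced[OF assms(1,2) less_imp_le[OF t] pos budget that(1) order_trans[OF rate that(2)]
        that(3)] .
  have "is_arg_max (min_rate M Bc \<Gamma>) (feasible M P) (balanced \<Gamma> t)"
    unfolding is_arg_max_def
  proof (intro conjI notI feas)
    assume "\<exists>q. feasible M P q \<and> min_rate M Bc \<Gamma> (balanced \<Gamma> t) < min_rate M Bc \<Gamma> q"
    then obtain q where q: "feasible M P q"
      "min_rate M Bc \<Gamma> (balanced \<Gamma> t) < min_rate M Bc \<Gamma> q" by blast
    \<comment> \<open>A strictly better \<open>q\<close> would agree with \<open>balanced\<close> on
      every channel and so have the same value.\<close>
    then have "min_rate M Bc \<Gamma> q = min_rate M Bc \<Gamma> (balanced \<Gamma> t)"
      using unique by (intro min_rate_cong) auto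
    with q(2) show False by simp
  qed
  moreover have "q 1 m < q 2 m"
    if "is_arg_max (min_rate M Bc \<Gamma>) (feasible M P) q" "m \<in> {1..M}" for q m
    \<comment> \<open>Since \<open>balanced \<Gamma> t\<close> is feasible, a maximizer
      \<open>q\<close> does at least as well, so \<open>unique\<close> applies to it.\<close>
    using that unique[of q m] less[of m] feas by (auto simp: is_arg_max_def not_less)
  ultimately show ?thesis
    unfolding SIC_stable_def by blast
qed

end
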